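(* The sample complexities of learning discrete distributions over a known domain of size $k$ in Kolmogorov distance, $\ell_\infty$ distance, and $\ell_2$ distance, to accuracy $\varepsilon$ and with error probability $\delta$, each satisfy $$\Phi(\mathrm{d}_{\rm K},k,\varepsilon,\delta),\ \Phi(\ell_\infty,k,\varepsilon,\delta),\ \Phi(\ell_2,k,\varepsilon,\delta) = \Theta\left(\frac{\log(1/\delta)}{\varepsilon^2}\right),$$ independent of $k$.
   Context: Let $[k]=\{1,\dots,k\}$ and let $\Delta([k])$ be the set of probability distributions on $[k]$. For $p,q\in\Delta([k])$, the Kolmogorov, $\ell_\infty$ and $\ell_2$ distances are $$\mathrm{d}_{\rm K}(p,q)=\max_{i\in[k]}\left|\sum_{j=1}^i p(j)-\sum_{j=1}^i q(j)\right|,\quad \ell_\infty(p,q)=\max_{i\in[k]}|p(i)-q(i)|,\quad \ell_2(p,q)=\sqrt{\sum_{i=1}^k(p(i)-q(i))^2}.$$ For a distance measure $\mathrm{d}$, an accuracy $\varepsilon>0$ and an error probability $\delta\in(0,1]$, $\Phi(\mathrm{d},k,\varepsilon,\delta)$ denotes the sample complexity of learning discrete distributions over the known domain $[k]$. That is, it is the smallest integer $n$ for which there is a (possibly randomized) estimator which, given $n$ i.i.d. samples from an unknown $p\in\Delta([k])$, outputs $\hat p\in\Delta([k])$ such that, for every $p\in\Delta([k])$, $\Pr[\mathrm{d}(p,\hat p)\le\varepsilon]\ge 1-\delta$. Asymptotics are taken with regard to $k$ going to infinity, $\varepsilon$ going to $0$, and $\delta$ going to $0$ (in that order). Thus $\Phi=\Theta(g)$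 means that there are absolute constants $0<c\le C$, $k_0$, $\varepsilon_0>0$, $\delta_0>0$ such that $c\,g\le\Phi\le C\,g$ for all $k\ge k_0$, $0<\varepsilon\le\varepsilon_0$, $0<\delta\le\delta_0$. *)

theory Defs
  imports "HOL-Probability.Probability"
begin

definition distributions :: "nat \<Rightarrow> nat pmf set" where
  "distributions k = {p. set_pmf p \<subseteq> {1..k}}"

(* The Borel sigma-algebra that the set of distributions inherits as a subset of R^k. *)
definition distribution_space :: "nat \<Rightarrow> nat pmf measure" where
  "distribution_space k =
     vimage_algebra (distributions k) (\<lambda>p. \<lambda>i\<in>{1..k}. pmf p i) (\<Pi>\<^sub>M i\<in>{1..k}. borel)"

type_synonym distance = "nat \<Rightarrow> nat pmf \<Rightarrow> nat pmf \<Rightarrow> real"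

(* The maxima below are meaningful for k \<ge> 1 only; for k = 0 there are no distributions. *)
definition kolmogorov_dist :: distance where
  "kolmogorov_dist k p q =
     (MAX i\<in>{1..k}. \<bar>(\<Sum>j=1..i. pmf p j) - (\<Sum>j=1..i. pmf q j)\<bar>)"

definition linf_dist :: distance where
  "linf_dist k p q = (MAX i\<in>{1..k}. \<bar>pmf p i - pmf q i\<bar>)"

definition l2_dist :: distance where
  "l2_dist k p q = sqrt (\<Sum>i=1..k. (pmf p i - pmf q i)\<^sup>2)"

(* A randomized estimator maps each sample list to the law of its output, i.e. it is a
   Markov kernel into the space of distributions.  The restriction to pmfs would only allow
   discrete internal randomness, so general probability measures are used.  Its values on
   lists other than n-tuples from {1..k} are irrelevant. *)
definition estimators :: "nat \<Rightarrow> (nat list \<Rightarrow> nat pmf measure) set" where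
  "estimators k = count_space UNIV \<rightarrow>\<^sub>M prob_algebra (distribution_space k)"

(* The law of the output, over both the n i.i.d. samples from p and the estimator's
   internal randomness. *)
definition output_law ::
    "nat \<Rightarrow> nat pmf \<Rightarrow> (nat list \<Rightarrow> nat pmf measure) \<Rightarrow> nat pmf measure" where
  "output_law n p K = measure_pmf (replicate_pmf n p) \<bind> K"

definition learns ::
    "distance \<Rightarrow> nat \<Rightarrow> real \<Rightarrow> real \<Rightarrow> nat \<Rightarrow> (nat list \<Rightarrow> nat pmf measure) \<Rightarrow> bool" where
  "learns d k \<epsilon> \<delta> n K \<longleftrightarrow>
     K \<in> estimators k \<and>
     (\<forall>p\<in>distributions k.
        measure (output_law n p K) {q \<in> distributions k. d k p q \<le> \<epsilon>} \<ge> 1 - \<delta>)"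

(* The infimum is taken in enat so that it is infinite when no sample size suffices. *)
definition sample_complexity :: "distance \<Rightarrow> nat \<Rightarrow> real \<Rightarrow> real \<Rightarrow> enat" where
  "sample_complexity d k \<epsilon> \<delta> = (INF n\<in>{n. \<exists>K. learns d k \<epsilon> \<delta> n K}. enat n)"

definition is_Theta ::
    "(nat \<Rightarrow> real \<Rightarrow> real \<Rightarrow> enat) \<Rightarrow> (nat \<Rightarrow> real \<Rightarrow> real \<Rightarrow> real) \<Rightarrow> bool" where
  "is_Theta \<Phi> g \<longleftrightarrow>
     (\<exists>c C k\<^sub>0 \<epsilon>\<^sub>0 \<delta>\<^sub>0. 0 < c \<and> c \<le> C \<and> 0 < \<epsilon>\<^sub>0 \<and> 0 < \<delta>\<^sub>0 \<and>
        (\<forall>k \<epsilon> \<delta>. k\<^sub>0 \<le> k \<longrightarrow> 0 < \<epsilon> \<longrightarrow> \<epsilon> \<le> \<epsilon>\<^sub>0 \<longrightarrow> 0 < \<delta> \<longrightarrow> \<delta> \<le> \<delta>\<^sub>0 \<longrightarrow>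
           ereal (c * g k \<epsilon> \<delta>) \<le> ereal_of_enat (\<Phi> k \<epsilon> \<delta>) \<and>
           ereal_of_enat (\<Phi> k \<epsilon> \<delta>) \<le> ereal (C * g k \<epsilon> \<delta>)))"

end

theory Submission
  imports Defs
begin

text \<open>Upper bound: with \<open>m = O(1/\<epsilon>\<^sup>2)\<close> samples the empirical distribution is \<open>\<epsilon>/2\<close>-close to the
  truth with a large constant probability, and by a majority argument valid for every pseudometric,
  \<open>O(log (1/\<delta>))\<close> independent repetitions bring the error probability down to \<open>\<delta>\<close>. For \<open>\<ell>\<^sub>2\<close> the constant-probability
  bound is Chebyshev's inequality, and \<open>\<ell>\<^sub>\<infinity> \<le> \<ell>\<^sub>2\<close>. For the Kolmogorov distance, a union bound would
  cost a factor \<open>log k\<close>; instead, \<open>(F\<^sub>n(t) - F(t)) / (1 - F(t))\<close> is a martingale in \<open>t\<close>, and Doob's \<open>L\<^sup>2\<close> maximal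
  inequality is applied while \<open>F(t) \<le> 1/2\<close>, the other half being symmetric.

  Lower bound: the distributions \<open>(1/2 + 2\<epsilon>, 1/2 - 2\<epsilon>)\<close> and \<open>(1/2 - 2\<epsilon>, 1/2 + 2\<epsilon>)\<close> have squared Hellinger
  affinity \<open>1 - 16\<epsilon>\<^sup>2\<close>, which is multiplicative, and a learner distinguishes them with error
  \<open>\<delta>\<close>, which forces \<open>(1 - 16\<epsilon>\<^sup>2)\<^sup>n \<le> 4\<delta>\<close>.\<close>

section \<open>Expectations over i.i.d. samples\<close>

text \<open>Finite support makes every real function of a sample integrable, so the expectations
  below are finite sums.\<close>

lemma finite_set_replicate_pmf:
  assumes "finite (set_pmf p)"
  shows "finite (set_pmf (replicate_pmf n p))"
  using finite_lists_length_eq[OF assms, of n]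
  by (rule rev_finite_subset) (auto simp: set_replicate_pmf)

lemma expectation_replicate_pmf_Suc:
  fixes h :: "'a list \<Rightarrow> real"
  assumes "finite (set_pmf p)"
  shows "measure_pmf.expectation (replicate_pmf (Suc n) p) h =
         measure_pmf.expectation p
           (\<lambda>x. measure_pmf.expectation (replicate_pmf n p) (\<lambda>xs. h (x # xs)))"
proof -
  have "replicate_pmf (Suc n) p = p \<bind> (\<lambda>x. map_pmf ((#) x) (replicate_pmf n p))"
    by (simp add: map_pmf_def)
  then show ?thesis
    using assms finite_set_replicate_pmf[OF assms, of n]
    by (simp add: pmf_expectation_bind[where A="set_pmf p"] integral_measure_pmf[where A="set_pmf p"]
        del: replicate_pmf.simps)
qed

text \<open>Lets a sample of size \<open>L * m\<close> be read as \<open>L\<close> independent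
  samples of size \<open>m\<close>, as boosting requires.\<close>

lemma replicate_pmf_mult:
  "replicate_pmf (L * m) p = map_pmf concat (replicate_pmf L (replicate_pmf m p))"
  by (induction L)
    (simp_all add: replicate_pmf_distrib map_pmf_def bind_assoc_pmf bind_return_pmf)

lemma pmf_expectation_mono:
  fixes f g :: "'a \<Rightarrow> real"
  assumes "finite (set_pmf p)" "\<And>x. x \<in> set_pmf p \<Longrightarrow> f x \<le> g x"
  shows "measure_pmf.expectation p f \<le> measure_pmf.expectation p g"
  using assms by (intro integral_mono_AE integrable_measure_pmf_finite) (auto simp: AE_measure_pmf_iff)

lemma pmf_Markov:
  fixes f :: "'a \<Rightarrow> real"
  assumes "finite (set_pmf p)" "\<And>x. 0 \<le> f x" "0 < a" "\<And>x. x \<in> set_pmf p \<Longrightarrow> x \<in> A \<Longrightarrow> a \<le> f x"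
  shows "measure_pmf.prob p A \<le> measure_pmf.expectation p f / a"
proof -
  have "measure_pmf.prob p A = measure_pmf.expectation p (indicator A)"
    by simp
  also have "\<dots> \<le> measure_pmf.expectation p (\<lambda>x. f x / a)"
    using assms by (intro pmf_expectation_mono) (auto simp: indicator_def divide_simps)
  finally show ?thesis by simp
qed

lemma expectation_replicate_pmf_prod_list:
  fixes f :: "'a \<Rightarrow> real"
  assumes "finite (set_pmf p)"
  shows "measure_pmf.expectation (replicate_pmf n p) (\<lambda>xs. \<Prod>x\<leftarrow>xs. f x) =
         measure_pmf.expectation p f ^ n"
proof (induction n)
  case (Suc n)
  then show ?case
    by (subst expectation_replicate_pmf_Suc[OF assms]) simp
qed simp

text \<open>Exponential Markov inequality for the number of failures, with base 36.\<close>
lemma replicate_pmf_majority: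
  assumes fin: "finite (set_pmf p)" and B: "measure_pmf.prob p B \<le> 1 / 36"
  shows "measure_pmf.prob (replicate_pmf L p) {xs. L \<le> 2 * length (filter (\<lambda>x. x \<in> B) xs)} \<le> (1 / 3) ^ L"
proof -
  define f :: "'a \<Rightarrow> real" where "f = (\<lambda>x. 1 + 35 * indicator B x)"
  have f: "measure_pmf.expectation p f = 1 + 35 * measure_pmf.prob p B"
    unfolding f_def using fin by (simp add: integrable_measure_pmf_finite)
  have prod: "(\<Prod>x\<leftarrow>xs. f x) = 6 ^ (2 * length (filter (\<lambda>x. x \<in> B) xs))" for xs
    by (induction xs) (simp_all add: f_def)
  have "measure_pmf.prob (replicate_pmf L p) {xs. L \<le> 2 * length (filter (\<lambda>x. x \<in> B) xs)}
      \<le> measure_pmf.expectation (replicate_pmf L p) (\<lambda>xs. \<Prod>x\<leftarrow>xs. f x) / 6 ^ L"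
    by (rule pmf_Markov) (simp_all add: finite_set_replicate_pmf fin prod power_increasing del: power_mult)
  also have "\<dots> = measure_pmf.expectation p f ^ L / 6 ^ L"
    by (simp add: expectation_replicate_pmf_prod_list fin)
  also have "\<dots> \<le> 2 ^ L / 6 ^ L"
    using B by (intro divide_right_mono power_mono) (auto simp: f)
  also have "\<dots> = (1 / 3) ^ L"
    by (simp flip: power_divide)
  finally show ?thesis .
qed

text \<open>Splitting off the head, the cross term factors by independence and vanishes because
  \<open>f\<close> has mean 0.\<close>

lemma expectation_sum_list_sq:
  fixes f :: "'a \<Rightarrow> real"
  assumes fin: "finite (set_pmf p)" and f: "measure_pmf.expectation p f = 0"
  shows "measure_pmf.expectation (replicate_pmf n p) (\<lambda>xs. (\<Sum>x\<leftarrow>xs. f x)\<^sup>2) =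
         n * measure_pmf.expectation p (\<lambda>x. (f x)\<^sup>2)"
proof (induction n)
  case (Suc n)
  note int = integrable_measure_pmf_finite[OF finite_set_replicate_pmf[OF fin]]
  have "measure_pmf.expectation (replicate_pmf (Suc n) p) (\<lambda>xs. (\<Sum>x\<leftarrow>xs. f x)\<^sup>2) =
     measure_pmf.expectation p (\<lambda>x. measure_pmf.expectation (replicate_pmf n p)
       (\<lambda>xs. (f x)\<^sup>2 + 2 * f x * (\<Sum>x\<leftarrow>xs. f x) + (\<Sum>x\<leftarrow>xs. f x)\<^sup>2))"
    by (subst expectation_replicate_pmf_Suc[OF fin]) (simp add: power2_sum add_ac)
  also have "\<dots> = measure_pmf.expectation p (\<lambda>x. (f x)\<^sup>2 +
       2 * f x * measure_pmf.expectation (replicate_pmf n p) (\<lambda>xs. \<Sum>x\<leftarrow>xs. f x)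
       + n * measure_pmf.expectation p (\<lambda>x. (f x)\<^sup>2))"
    by (intro Bochner_Integration.integral_cong refl)
      (simp only: Bochner_Integration.integral_add int Bochner_Integration.integrable_add
        integral_mult_right_zero Suc.IH lebesgue_integral_const measure_pmf.prob_space scaleR_one)
  also have "\<dots> = Suc n * measure_pmf.expectation p (\<lambda>x. (f x)\<^sup>2)"
    by (simp add: integrable_measure_pmf_finite fin f algebra_simps)
  finally show ?case .
qed simp

text \<open>The martingale property without conditional expectations: \<open>G\<close> does not
  notice how sample points outside \<open>S\<close> are moved within the complement, while
  \<open>d\<close> lives there and has mean 0, so increment and past are orthogonal.\<close>

lemma expectation_sum_list_orthogonal:
  fixes d :: "'a \<Rightarrow> real" and G :: "'a list \<Rightarrow> real"
  assumes fin: "finite (set_pmf p)" and d0: "\<And>x. x \<in> S \<Longrightarrow> d x = 0"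
    and Ed: "measure_pmf.expectation p d = 0"
    and G: "\<And>xs ys. list_all2 (\<lambda>x y. x = y \<or> x \<notin> S \<and> y \<notin> S) xs ys \<Longrightarrow> G xs = G ys"
  shows "measure_pmf.expectation (replicate_pmf n p) (\<lambda>xs. (\<Sum>x\<leftarrow>xs. d x) * G xs) = 0"
  using G
proof (induction n arbitrary: G)
  case 0
  show ?case by simp
next
  case (Suc n)
  note int = integrable_measure_pmf_finite[OF finite_set_replicate_pmf[OF fin]]
  \<comment> \<open>Where \<open>d x\<close> is nonzero, \<open>x\<close> lies outside
    \<open>S\<close>, and \<open>G\<close> keeps its value if the head becomes one fixed point
    outside \<open>S\<close>. The inner expectation is then constant and the mean of
    \<open>d\<close> factors out.\<close>
  have head: "d x * measure_pmf.expectation (replicate_pmf n p) (\<lambda>xs. G (x # xs))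
       = d x * measure_pmf.expectation (replicate_pmf n p) (\<lambda>xs. G ((SOME y. y \<notin> S) # xs))" for x
  proof (cases "x \<in> S")
    case False
    then have "(SOME y. y \<notin> S) \<notin> S"
      by (rule someI)
    with False have "G (x # xs) = G ((SOME y. y \<notin> S) # xs)" for xs
      by (intro Suc.prems) (auto intro: list_all2_refl)
    then show ?thesis by simp
  qed (simp add: d0)
  have tail: "measure_pmf.expectation (replicate_pmf n p) (\<lambda>xs. (\<Sum>x\<leftarrow>xs. d x) * G (x # xs)) = 0" for x
    by (rule Suc.IH) (auto intro: Suc.prems)
  have "measure_pmf.expectation (replicate_pmf (Suc n) p) (\<lambda>xs. (\<Sum>x\<leftarrow>xs. d x) * G xs) =
    measure_pmf.expectation p (\<lambda>x.
       d x * measure_pmf.expectation (replicate_pmf n p) (\<lambda>xs. G (x # xs)))"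
    by (subst expectation_replicate_pmf_Suc[OF fin])
      (simp add: distrib_right int tail)
  also have "\<dots> = 0"
    by (simp only: head) (simp add: Ed)
  finally show ?case .
qed

section \<open>A maximal inequality along chains of sets\<close>

text \<open>Averaged over a sample, this is (F_n - F) / (1 - F), with F the mass of \<open>S\<close>
  and F_n its empirical frequency. It is 1 on \<open>S\<close> and constant off \<open>S\<close>, so
  the difference for two nested sets vanishes on the smaller one.\<close>

definition tail_martingale :: "'a pmf \<Rightarrow> 'a set \<Rightarrow> 'a \<Rightarrow> real" where
  "tail_martingale p S x = 1 - indicator (- S) x / (1 - measure_pmf.prob p S)"

lemma prob_Compl: "measure_pmf.prob p (- S) = 1 - measure_pmf.prob p S"
  using measure_pmf.prob_compl[of S p] by (simp add: Compl_eq_Diff_UNIV)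

text \<open>The variance is the mass of \<open>S\<close> divided by that of its complement, hence at
  most 1 up to mass 1/2.\<close>

lemma expectation_tail_martingale:
  assumes "finite (set_pmf p)" "measure_pmf.prob p S \<le> 1 / 2"
  shows "measure_pmf.expectation p (tail_martingale p S) = 0"
    and "measure_pmf.expectation p (\<lambda>x. (tail_martingale p S x)\<^sup>2) \<le> 1"
proof -
  note int = integrable_measure_pmf_finite[OF assms(1)]
  define r where "r = 1 - measure_pmf.prob p S"
  have r: "r \<ge> 1 / 2" using assms(2) by (simp add: r_def)
  show "measure_pmf.expectation p (tail_martingale p S) = 0"
    using r by (simp add: tail_martingale_def[abs_def] int prob_Compl flip: r_def)
  have "(tail_martingale p S x)\<^sup>2 = 1 + (1 / r\<^sup>2 - 2 / r) * indicator (- S) x" for x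
    using r by (simp add: tail_martingale_def indicator_def power2_diff power_divide flip: r_def)
  then have "measure_pmf.expectation p (\<lambda>x. (tail_martingale p S x)\<^sup>2) = 1 + (1 / r\<^sup>2 - 2 / r) * r"
    by (simp add: int prob_Compl flip: r_def)
  also have "\<dots> = 1 / r - 1"
    using r by (simp add: field_simps power2_eq_square)
  also have "\<dots> \<le> 1"
    using r by (simp add: field_simps)
  finally show "measure_pmf.expectation p (\<lambda>x. (tail_martingale p S x)\<^sup>2) \<le> 1" .
qed

text \<open>The centred count is \<open>1 - measure_pmf.prob p S\<close> times the martingale value.
  This factor is at most 1, so maximal bounds carry over to counts.\<close>

lemma sum_list_tail_martingale:
  assumes "measure_pmf.prob p S \<le> 1 / 2"
  shows "\<bar>real (length (filter (\<lambda>x. x \<in> S) xs)) - length xs * measure_pmf.prob p S\<bar>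
       \<le> \<bar>\<Sum>x\<leftarrow>xs. tail_martingale p S x\<bar>"
proof -
  define r where "r = 1 - measure_pmf.prob p S"
  have r: "r \<ge> 1 / 2" "r \<le> 1" using assms by (simp_all add: r_def)
  have "real (length (filter (\<lambda>x. x \<in> S) xs)) - length xs * measure_pmf.prob p S
      = r * (\<Sum>x\<leftarrow>xs. tail_martingale p S x)"
  proof (induction xs)
    case (Cons x xs)
    have "r * tail_martingale p S x = indicator S x - measure_pmf.prob p S"
      using r by (simp add: tail_martingale_def indicator_def r_def right_diff_distrib)
    with Cons show ?case by (simp add: algebra_simps)
  qed simp
  moreover have "\<bar>r * s\<bar> \<le> \<bar>s\<bar>" for s :: real
    using r by (simp add: abs_mult mult_left_le_one_le)
  ultimately show ?thesis by simp
qed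

text \<open>Doob's \<open>L\<^sup>2\<close> argument: along an increasing chain of sets the rescaled deviations of the
  empirical frequencies form a martingale, because given which sample points lie outside
  \<^term>\<open>S t\<close> their exact positions are conditionally independent with law
  \<^term>\<open>p\<close> restricted to \<^term>\<open>- S t\<close>.\<close>
lemma tail_martingale_maximal:
  fixes S :: "nat \<Rightarrow> 'a set"
  assumes fin: "finite (set_pmf p)" and S: "mono S" and a: "0 < a"
    and T: "measure_pmf.prob p (S T) \<le> 1 / 2"
  shows "measure_pmf.prob (replicate_pmf n p)
           {xs. \<exists>t\<le>T. a \<le> \<bar>\<Sum>x\<leftarrow>xs. tail_martingale p (S t) x\<bar>} \<le> n / a\<^sup>2"
proof -
  define m where "m = (\<lambda>t. tail_martingale p (S t))"
  define M where "M = (\<lambda>t xs. \<Sum>x\<leftarrow>xs. m t x)"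
  define B where "B = (\<lambda>t. {xs. \<exists>s\<le>t. a \<le> \<bar>M s xs\<bar>})"
  note int = integrable_measure_pmf_finite[OF finite_set_replicate_pmf[OF fin]]
  have half: "measure_pmf.prob p (S t) \<le> 1 / 2" if "t \<le> T" for t
    using monoD[OF S that] T measure_pmf.finite_measure_mono[of "S t" "S T" p] by simp
  have Em: "measure_pmf.expectation p (m t) = 0" if "t \<le> T" for t
    unfolding m_def using fin half[OF that] by (rule expectation_tail_martingale)
  \<comment> \<open>\<open>B t\<close> says that level \<open>a\<close> was reached by time
    \<open>t\<close>. This invariant is Doob's inequality in integrated form and replaces a stopping
    time.\<close>
  have doob: "0 \<le> measure_pmf.expectation (replicate_pmf n p) (\<lambda>xs. ((M t xs)\<^sup>2 - a\<^sup>2) * indicator (B t) xs)"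
    if "t \<le> T" for t
    using that
  proof (induction t)
    case 0
    show ?case
    proof (rule Bochner_Integration.integral_nonneg)
      fix xs
      show "0 \<le> ((M 0 xs)\<^sup>2 - a\<^sup>2) * indicator (B 0) xs"
        using a by (auto simp: B_def indicator_def intro: abs_le_square_iff[THEN iffD1])
    qed
  next
    case (Suc t)
    define d where "d = (\<lambda>x. m (Suc t) x - m t x)"
    define G where "G = (\<lambda>xs. M t xs * indicator (B t) xs)"
    have sub: "S t \<subseteq> S (Suc t)" using S by (simp add: monoD)
    have MM: "M (Suc t) xs = M t xs + (\<Sum>x\<leftarrow>xs. d x)" for xs
      unfolding M_def d_def by (simp add: sum_list_subtractf)
    have orth: "measure_pmf.expectation (replicate_pmf n p) (\<lambda>xs. (\<Sum>x\<leftarrow>xs. d x) * G xs) = 0"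
    proof (rule expectation_sum_list_orthogonal[OF fin, where S="S t"])
      show "d x = 0" if "x \<in> S t" for x
        using that sub by (auto simp: d_def m_def tail_martingale_def)
      show "measure_pmf.expectation p d = 0"
        using Suc.prems by (simp add: d_def Em integrable_measure_pmf_finite[OF fin])
      fix xs ys
      assume xy: "list_all2 (\<lambda>x y. x = y \<or> x \<notin> S t \<and> y \<notin> S t) xs ys"
      \<comment> \<open>Up to time \<open>t\<close>, each \<open>m s\<close> is constant outside
        \<open>S t\<close>, because \<open>S s\<close> is contained in \<open>S t\<close>; so
        \<open>G\<close> cannot tell \<open>xs\<close> from \<open>ys\<close>.\<close>
      have "map (m s) xs = map (m s) ys" if "s \<le> t" for s
      proof -
        have "list_all2 (\<lambda>x y. m s x = m s y) xs ys"
          using monoD[OF S that] by (intro list_all2_mono[OF xy]) (auto simp: m_def tail_martingale_def indicator_def)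
        then show ?thesis
          by (simp add: list.rel_eq[symmetric] list.rel_map)
      qed
      then have "M s xs = M s ys" if "s \<le> t" for s
        using that by (simp add: M_def)
      then show "G xs = G ys"
        by (auto simp: G_def B_def indicator_def)
    qed
    have "0 \<le> measure_pmf.expectation (replicate_pmf n p) (\<lambda>xs. ((M t xs)\<^sup>2 - a\<^sup>2) * indicator (B t) xs)
        + 2 * measure_pmf.expectation (replicate_pmf n p) (\<lambda>xs. (\<Sum>x\<leftarrow>xs. d x) * G xs)"
      using Suc by (simp add: orth)
    also have "\<dots> = measure_pmf.expectation (replicate_pmf n p)
        (\<lambda>xs. ((M t xs)\<^sup>2 - a\<^sup>2) * indicator (B t) xs + 2 * ((\<Sum>x\<leftarrow>xs. d x) * G xs))"
      by (simp only: Bochner_Integration.integral_add int integral_mult_right_zero)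
    also have "\<dots> \<le> measure_pmf.expectation (replicate_pmf n p)
        (\<lambda>xs. ((M (Suc t) xs)\<^sup>2 - a\<^sup>2) * indicator (B (Suc t)) xs)"
    proof (rule pmf_expectation_mono[OF finite_set_replicate_pmf[OF fin]])
      fix xs
      \<comment> \<open>On \<open>B t\<close> the right side exceeds the left by the square of the
        increment; on first entry at \<open>Suc t\<close> the left side is 0 and the right side
        nonnegative; otherwise both are 0.\<close>
      consider "xs \<in> B t" | "xs \<notin> B t" "xs \<in> B (Suc t)" | "xs \<notin> B (Suc t)" by blast
      then show "((M t xs)\<^sup>2 - a\<^sup>2) * indicator (B t) xs + 2 * ((\<Sum>x\<leftarrow>xs. d x) * G xs)
          \<le> ((M (Suc t) xs)\<^sup>2 - a\<^sup>2) * indicator (B (Suc t)) xs"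
      proof cases
        case 1
        then have "xs \<in> B (Suc t)" by (auto simp: B_def intro: le_SucI)
        with 1 show ?thesis by (simp add: G_def MM power2_sum)
      next
        case 2
        then have "a \<le> \<bar>M (Suc t) xs\<bar>" by (auto simp: B_def le_Suc_eq)
        then have "a\<^sup>2 \<le> (M (Suc t) xs)\<^sup>2" using a abs_le_square_iff[of a] by simp
        with 2 show ?thesis by (simp add: G_def)
      next
        case 3
        then have "xs \<notin> B t" by (auto simp: B_def intro: le_SucI)
        with 3 show ?thesis by (simp add: G_def)
      qed
    qed
    finally show ?case .
  qed
  have "a\<^sup>2 * measure_pmf.prob (replicate_pmf n p) (B T)
      = measure_pmf.expectation (replicate_pmf n p) (\<lambda>xs. a\<^sup>2 * indicator (B T) xs)"
    by simp
  also have "\<dots> \<le> measure_pmf.expectation (replicate_pmf n p) (\<lambda>xs. a\<^sup>2 * indicator (B T) xs)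
      + measure_pmf.expectation (replicate_pmf n p) (\<lambda>xs. ((M T xs)\<^sup>2 - a\<^sup>2) * indicator (B T) xs)"
    using doob[of T] by simp
  also have "\<dots> = measure_pmf.expectation (replicate_pmf n p)
      (\<lambda>xs. a\<^sup>2 * indicator (B T) xs + ((M T xs)\<^sup>2 - a\<^sup>2) * indicator (B T) xs)"
    by (simp only: Bochner_Integration.integral_add int)
  also have "\<dots> \<le> measure_pmf.expectation (replicate_pmf n p) (\<lambda>xs. (M T xs)\<^sup>2)"
    by (rule pmf_expectation_mono[OF finite_set_replicate_pmf[OF fin]]) (auto simp: indicator_def)
  also have "\<dots> = n * measure_pmf.expectation p (\<lambda>x. (m T x)\<^sup>2)"
    unfolding M_def by (rule expectation_sum_list_sq[OF fin Em]) simp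
  also have "\<dots> \<le> n"
    using expectation_tail_martingale(2)[OF fin T] by (simp add: m_def mult_left_le)
  finally show ?thesis
    using a by (simp add: B_def M_def m_def field_simps)
qed

lemma chain_deviation:
  fixes S :: "nat \<Rightarrow> 'a set"
  assumes fin: "finite (set_pmf p)" and S: "mono S" and a: "0 < a"
  shows "measure_pmf.prob (replicate_pmf n p)
           {xs. \<exists>t\<le>N. measure_pmf.prob p (S t) \<le> 1 / 2 \<and>
              a \<le> \<bar>real (length (filter (\<lambda>x. x \<in> S t) xs)) - n * measure_pmf.prob p (S t)\<bar>} \<le> n / a\<^sup>2"
    (is "measure_pmf.prob _ ?X \<le> _")
proof (cases "\<exists>t\<le>N. measure_pmf.prob p (S t) \<le> 1 / 2")
  case True
  \<comment> \<open>Masses increase along the chain, so the indices with mass at most 1/2 form an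
    initial segment, and the maximal inequality applies up to the last of them.\<close>
  define A where "A = {t. t \<le> N \<and> measure_pmf.prob p (S t) \<le> 1 / 2}"
  have A: "finite A" "A \<noteq> {}" using True by (auto simp: A_def)
  then have "Max A \<in> A" by (rule Max_in)
  then have T: "measure_pmf.prob p (S (Max A)) \<le> 1 / 2" by (simp add: A_def)
  have "measure_pmf.prob (replicate_pmf n p) ?X \<le> measure_pmf.prob (replicate_pmf n p)
           {xs. \<exists>t\<le>Max A. a \<le> \<bar>\<Sum>x\<leftarrow>xs. tail_martingale p (S t) x\<bar>}"
  proof (rule measure_pmf.finite_measure_mono_AE)
    show "AE xs in replicate_pmf n p. xs \<in> ?X \<longrightarrow>
        xs \<in> {xs. \<exists>t\<le>Max A. a \<le> \<bar>\<Sum>x\<leftarrow>xs. tail_martingale p (S t) x\<bar>}"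
    proof (intro AE_pmfI impI)
      fix xs assume xs: "xs \<in> set_pmf (replicate_pmf n p)" "xs \<in> ?X"
      then have n: "length xs = n" by (simp add: set_replicate_pmf)
      from xs obtain t where t: "t \<in> A"
          "a \<le> \<bar>real (length (filter (\<lambda>x. x \<in> S t) xs)) - n * measure_pmf.prob p (S t)\<bar>"
        by (auto simp: A_def)
      moreover have "t \<le> Max A" using A t by simp
      ultimately show "xs \<in> {xs. \<exists>t\<le>Max A. a \<le> \<bar>\<Sum>x\<leftarrow>xs. tail_martingale p (S t) x\<bar>}"
        using sum_list_tail_martingale[of p "S t" xs] n by (auto simp: A_def intro!: exI[of _ t])
    qed
  qed simp
  then show ?thesis using tail_martingale_maximal[OF fin S a T] by (rule order_trans)
next
  case False
  then have "?X = {}" by blast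
  then show ?thesis by (simp only:) simp
qed

section \<open>Empirical distributions\<close>

abbreviation empirical :: "'a list \<Rightarrow> 'a pmf" where
  "empirical xs \<equiv> pmf_of_multiset (mset xs)"

lemma prob_empirical:
  assumes "xs \<noteq> []"
  shows "measure_pmf.prob (empirical xs) S = length (filter (\<lambda>x. x \<in> S) xs) / length xs"
proof -
  have "size (filter_mset (\<lambda>x. x \<in> S) (mset xs)) = (\<Sum>x\<in>S \<inter> set xs. count (mset xs) x)"
    unfolding size_multiset_overloaded_eq by (intro sum.cong) auto
  then have len: "length (filter (\<lambda>x. x \<in> S) xs) = (\<Sum>x\<in>S \<inter> set xs. count (mset xs) x)"
    by (simp flip: mset_filter)
  have "measure_pmf.prob (empirical xs) S = measure_pmf.prob (empirical xs) (S \<inter> set xs)"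
    using assms measure_Int_set_pmf[of "empirical xs" S] by simp
  also have "\<dots> = (\<Sum>x\<in>S \<inter> set xs. count (mset xs) x / length xs)"
    using assms by (simp add: measure_measure_pmf_finite)
  also have "\<dots> = length (filter (\<lambda>x. x \<in> S) xs) / length xs"
    by (simp add: len sum_divide_distrib)
  finally show ?thesis .
qed

lemma empirical_in_distributions:
  assumes "p \<in> distributions k" "0 < m" "xs \<in> set_pmf (replicate_pmf m p)"
  shows "empirical xs \<in> distributions k"
  using assms by (auto simp: distributions_def set_replicate_pmf)

lemma finite_set_distributions:
  "p \<in> distributions k \<Longrightarrow> finite (set_pmf p)"
  by (auto simp: distributions_def intro: finite_subset)

lemma kolmogorov_dist_prob:
  "kolmogorov_dist k p q =
     (MAX i\<in>{1..k}. \<bar>measure_pmf.prob p {1..i} - measure_pmf.prob q {1..i}\<bar>)"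
  by (simp add: kolmogorov_dist_def measure_measure_pmf_finite)

text \<open>Each initial segment or its complement has mass at most 1/2, and both deviate equally in
  absolute value. Segments and complements form two chains, each contributing
  \<open>1 / (m * \<eta>\<^sup>2)\<close> whatever \<open>k\<close> is.\<close>

lemma kolmogorov_dist_empirical:
  assumes p: "p \<in> distributions k" and k: "1 \<le> k" and m: "0 < m" and \<eta>: "0 < \<eta>"
  shows "measure_pmf.prob (replicate_pmf m p) {xs. \<eta> < kolmogorov_dist k p (empirical xs)}
           \<le> 2 / (m * \<eta>\<^sup>2)"
proof -
  define dev where "dev = (\<lambda>S xs. real (length (filter (\<lambda>x. x \<in> S) xs)) - m * measure_pmf.prob p S)"
  define X where "X = (\<lambda>S. {xs. \<exists>t\<le>k. measure_pmf.prob p (S t) \<le> 1 / 2 \<and> m * \<eta> \<le> \<bar>dev (S t) xs\<bar>})"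
  define lower where "lower = (\<lambda>t::nat. {1..t})"
  \<comment> \<open>Reversing the index makes the complements an increasing chain; segment
    \<open>i\<close> is met at time \<open>k - i\<close>.\<close>
  define upper where "upper = (\<lambda>t::nat. - {1..k - t})"
  have X: "measure_pmf.prob (replicate_pmf m p) (X S) \<le> 1 / (m * \<eta>\<^sup>2)" if "mono S" for S
  proof -
    have "measure_pmf.prob (replicate_pmf m p) (X S) \<le> m / (m * \<eta>)\<^sup>2"
      unfolding X_def dev_def
      using finite_set_distributions[OF p] that m \<eta> by (intro chain_deviation) auto
    also have "\<dots> = 1 / (m * \<eta>\<^sup>2)"
      using m by (simp add: power2_eq_square)
    finally show ?thesis .
  qed
  have mono: "mono lower" "mono upper"
    by (auto simp: lower_def upper_def mono_def)
  have "measure_pmf.prob (replicate_pmf m p) {xs. \<eta> < kolmogorov_dist k p (empirical xs)}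
      \<le> measure_pmf.prob (replicate_pmf m p) (X lower \<union> X upper)"
  proof (rule measure_pmf.finite_measure_mono_AE)
    show "AE xs in replicate_pmf m p. xs \<in> {xs. \<eta> < kolmogorov_dist k p (empirical xs)} \<longrightarrow>
        xs \<in> X lower \<union> X upper"
    proof (intro AE_pmfI impI)
      fix xs assume xs: "xs \<in> set_pmf (replicate_pmf m p)"
        "xs \<in> {xs. \<eta> < kolmogorov_dist k p (empirical xs)}"
      then have len: "length xs = m" "xs \<noteq> []" using m by (auto simp: set_replicate_pmf)
      from xs(2) obtain i where i: "i \<in> {1..k}"
          "\<eta> < \<bar>measure_pmf.prob p {1..i} - measure_pmf.prob (empirical xs) {1..i}\<bar>"
        using k by (auto simp: kolmogorov_dist_prob Max_gr_iff)
      have "dev {1..i} xs = m * (measure_pmf.prob (empirical xs) {1..i} - measure_pmf.prob p {1..i})"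
        using len m by (simp add: dev_def prob_empirical field_simps)
      then have dev: "m * \<eta> \<le> \<bar>dev {1..i} xs\<bar>"
        using i(2) m by (simp add: abs_mult abs_minus_commute)
      have "length (filter (\<lambda>x. x \<in> {1..i}) xs) + length (filter (\<lambda>x. x \<in> - {1..i}) xs) = m"
        using sum_length_filter_compl[of "\<lambda>x. x \<in> {1..i}" xs] len by simp
      then have "dev (- {1..i}) xs = - dev {1..i} xs"
        by (simp add: dev_def prob_Compl right_diff_distrib flip: of_nat_add)
      then have dev': "m * \<eta> \<le> \<bar>dev (- {1..i}) xs\<bar>"
        using dev by simp
      show "xs \<in> X lower \<union> X upper"
      proof (cases "measure_pmf.prob p {1..i} \<le> 1 / 2")
        case True
        then have "xs \<in> X lower"
          using i dev by (auto simp: X_def lower_def)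
        then show ?thesis ..
      next
        case False
        then have "measure_pmf.prob p (- {1..i}) \<le> 1 / 2"
          by (simp add: prob_Compl)
        then have "xs \<in> X upper"
          using i dev' by (auto simp: X_def upper_def intro!: exI[of _ "k - i"])
        then show ?thesis ..
      qed
    qed
  qed simp
  also have "\<dots> \<le> measure_pmf.prob (replicate_pmf m p) (X lower) + measure_pmf.prob (replicate_pmf m p) (X upper)"
    by (rule measure_Un_le) auto
  also have "\<dots> \<le> 2 / (m * \<eta>\<^sup>2)"
    using add_mono[OF X[OF mono(1)] X[OF mono(2)]] by (simp flip: add_divide_distrib)
  finally show ?thesis .
qed

text \<open>Markov's inequality for the squared norm of the centred count vector: the variance of
  coordinate \<open>i\<close> is at most \<open>m * pmf p i\<close>, and these bounds add up to
  \<open>m\<close>, independently of \<open>k\<close>.\<close>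

lemma l2_dist_empirical:
  assumes p: "p \<in> distributions k" and m: "0 < m" and \<eta>: "0 < \<eta>"
  shows "measure_pmf.prob (replicate_pmf m p) {xs. \<eta> < l2_dist k p (empirical xs)}
           \<le> 1 / (m * \<eta>\<^sup>2)"
proof -
  note fin = finite_set_distributions[OF p]
  note int = integrable_measure_pmf_finite[OF fin]
    integrable_measure_pmf_finite[OF finite_set_replicate_pmf[OF fin]]
  define f where "f = (\<lambda>i x. indicator {i} x - pmf p i)"
  have Ef: "measure_pmf.expectation p (f i) = 0" for i
    unfolding f_def by (simp add: int measure_pmf_single)
  have Ef2: "measure_pmf.expectation p (\<lambda>x. (f i x)\<^sup>2) \<le> pmf p i" for i
  proof -
    have "(f i x)\<^sup>2 = (1 - 2 * pmf p i) * indicator {i} x + (pmf p i)\<^sup>2" for x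
      by (simp add: f_def indicator_def power2_diff)
    then have "measure_pmf.expectation p (\<lambda>x. (f i x)\<^sup>2) = (1 - 2 * pmf p i) * pmf p i + (pmf p i)\<^sup>2"
      by (simp add: int measure_pmf_single)
    also have "\<dots> = pmf p i - (pmf p i)\<^sup>2"
      by (simp add: power2_eq_square algebra_simps)
    finally show ?thesis by simp
  qed
  have "measure_pmf.prob (replicate_pmf m p) {xs. \<eta> < l2_dist k p (empirical xs)}
      \<le> measure_pmf.expectation (replicate_pmf m p) (\<lambda>xs. \<Sum>i=1..k. (\<Sum>x\<leftarrow>xs. f i x)\<^sup>2) / (m * \<eta>)\<^sup>2"
  proof (rule pmf_Markov)
    fix xs assume xs: "xs \<in> set_pmf (replicate_pmf m p)" "xs \<in> {xs. \<eta> < l2_dist k p (empirical xs)}"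
    then have len: "length xs = m" "xs \<noteq> []" using m by (auto simp: set_replicate_pmf)
    have "(\<Sum>x\<leftarrow>xs. f i x) = real (count (mset xs) i) - length xs * pmf p i" for i
      by (induction xs) (auto simp: f_def algebra_simps)
    then have "(\<Sum>x\<leftarrow>xs. f i x) = - (m * (pmf p i - pmf (empirical xs) i))" for i
      using len m by (simp add: right_diff_distrib)
    then have "(\<Sum>i=1..k. (\<Sum>x\<leftarrow>xs. f i x)\<^sup>2) = (real m)\<^sup>2 * (\<Sum>i=1..k. (pmf p i - pmf (empirical xs) i)\<^sup>2)"
      by (simp only: power2_minus power_mult_distrib sum_distrib_left)
    also have "\<dots> = (m * l2_dist k p (empirical xs))\<^sup>2"
      by (simp add: l2_dist_def power_mult_distrib sum_nonneg)
    also have "\<dots> \<ge> (m * \<eta>)\<^sup>2"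
      using xs(2) \<eta> by (intro power_mono mult_left_mono) auto
    finally show "(m * \<eta>)\<^sup>2 \<le> (\<Sum>i=1..k. (\<Sum>x\<leftarrow>xs. f i x)\<^sup>2)" .
  qed (use m \<eta> finite_set_replicate_pmf[OF fin] in \<open>auto intro: sum_nonneg\<close>)
  also have "measure_pmf.expectation (replicate_pmf m p) (\<lambda>xs. \<Sum>i=1..k. (\<Sum>x\<leftarrow>xs. f i x)\<^sup>2)
      = (\<Sum>i=1..k. m * measure_pmf.expectation p (\<lambda>x. (f i x)\<^sup>2))"
    by (simp add: int Bochner_Integration.integral_sum expectation_sum_list_sq fin Ef)
  also have "(\<Sum>i=1..k. m * measure_pmf.expectation p (\<lambda>x. (f i x)\<^sup>2)) / (m * \<eta>)\<^sup>2
      \<le> (\<Sum>i=1..k. m * pmf p i) / (m * \<eta>)\<^sup>2"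
    by (intro divide_right_mono sum_mono mult_left_mono Ef2) auto
  also have "(\<Sum>i=1..k. m * pmf p i) = m"
    using p by (simp add: sum_pmf_eq_1 distributions_def flip: sum_distrib_left)
  also have "m / (m * \<eta>)\<^sup>2 = 1 / (m * \<eta>\<^sup>2)"
    using m by (simp add: power2_eq_square)
  finally show ?thesis .
qed

section \<open>Comparison and triangle inequalities for the distances\<close>

lemma pmf_diff_le_linf_dist:
  assumes "i \<in> {1..k}"
  shows "\<bar>pmf p i - pmf q i\<bar> \<le> linf_dist k p q"
  unfolding linf_dist_def using assms by (intro Max_ge) auto

lemma linf_dist_le_l2_dist:
  assumes "1 \<le> k"
  shows "linf_dist k p q \<le> l2_dist k p q"
proof -
  have "\<bar>pmf p i - pmf q i\<bar> \<le> l2_dist k p q" if "i \<in> {1..k}" for i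
  proof -
    have "(pmf p i - pmf q i)\<^sup>2 \<le> (\<Sum>i=1..k. (pmf p i - pmf q i)\<^sup>2)"
      using that by (intro member_le_sum) auto
    then show ?thesis
      unfolding l2_dist_def by (metis real_sqrt_abs real_sqrt_le_iff)
  qed
  then show ?thesis
    using assms by (auto simp: linf_dist_def)
qed

lemma pmf_1_diff_le_kolmogorov_dist:
  assumes "1 \<le> k"
  shows "\<bar>pmf p 1 - pmf q 1\<bar> \<le> kolmogorov_dist k p q"
proof -
  have "\<bar>(\<Sum>j=1..1. pmf p j) - (\<Sum>j=1..1. pmf q j)\<bar> \<le> kolmogorov_dist k p q"
    unfolding kolmogorov_dist_def using assms by (intro Max_ge image_eqI[where x=1]) auto
  then show ?thesis by simp
qed

lemma MAX_abs_diff_triangle: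
  fixes a b c :: "'a \<Rightarrow> real"
  assumes "finite I" "I \<noteq> {}"
  shows "(MAX i\<in>I. \<bar>a i - b i\<bar>) \<le> (MAX i\<in>I. \<bar>a i - c i\<bar>) + (MAX i\<in>I. \<bar>b i - c i\<bar>)"
proof -
  have "\<bar>a i - b i\<bar> \<le> (MAX i\<in>I. \<bar>a i - c i\<bar>) + (MAX i\<in>I. \<bar>b i - c i\<bar>)" if "i \<in> I" for i
  proof -
    have "\<bar>a i - b i\<bar> \<le> \<bar>a i - c i\<bar> + \<bar>b i - c i\<bar>" by simp
    also have "\<dots> \<le> (MAX i\<in>I. \<bar>a i - c i\<bar>) + (MAX i\<in>I. \<bar>b i - c i\<bar>)"
      using assms that by (intro add_mono Max_ge) auto
    finally show ?thesis .
  qed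
  then show ?thesis using assms by simp
qed

lemma l2_dist_triangle:
  "l2_dist k p q \<le> l2_dist k p r + l2_dist k q r"
proof -
  have eq: "l2_dist k p q = L2_set (\<lambda>i. (pmf p i - pmf r i) + (pmf r i - pmf q i)) {1..k}"
    by (simp add: l2_dist_def L2_set_def)
  have "\<dots> \<le> L2_set (\<lambda>i. pmf p i - pmf r i) {1..k} + L2_set (\<lambda>i. pmf r i - pmf q i) {1..k}"
    by (rule L2_set_triangle_ineq)
  then show ?thesis
    unfolding eq by (simp add: l2_dist_def L2_set_def power2_commute)
qed

section \<open>Measurability on the space of distributions\<close>

lemma space_distribution_space [simp]: "space (distribution_space k) = distributions k"
  by (simp add: distribution_space_def)

lemma measurable_pmf_distribution_space:
  assumes "i \<in> {1..k}"
  shows "(\<lambda>q. pmf q i) \<in> borel_measurable (distribution_space k)"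
proof -
  have "(\<lambda>q. \<lambda>i\<in>{1..k}. pmf q i) \<in> distribution_space k \<rightarrow>\<^sub>M (\<Pi>\<^sub>M i\<in>{1..k}. borel :: real measure)"
    unfolding distribution_space_def by (rule measurable_vimage_algebra1) (auto simp: space_PiM)
  from measurable_compose[OF this measurable_component_singleton[OF assms]]
  show ?thesis using assms by simp
qed

lemma borel_measurable_l2_dist: "l2_dist k p \<in> borel_measurable (distribution_space k)"
  unfolding l2_dist_def[abs_def]
  by (intro measurable_compose[OF _ borel_measurable_sqrt] borel_measurable_sum borel_measurable_power borel_measurable_diff
      borel_measurable_const measurable_pmf_distribution_space)

lemma borel_measurable_linf_dist:
  "linf_dist k p \<in> borel_measurable (distribution_space k)"
  unfolding linf_dist_def[abs_def]
  by (intro borel_measurable_Max borel_measurable_abs borel_measurable_diff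
      borel_measurable_const measurable_pmf_distribution_space) auto

lemma borel_measurable_kolmogorov_dist:
  "kolmogorov_dist k p \<in> borel_measurable (distribution_space k)"
  unfolding kolmogorov_dist_def[abs_def]
  by (intro borel_measurable_Max borel_measurable_abs borel_measurable_diff borel_measurable_sum
      borel_measurable_const measurable_pmf_distribution_space) auto

section \<open>Lower bound and boosting\<close>

lemma measure_output_law:
  assumes K: "K \<in> estimators k" and X: "X \<in> sets (distribution_space k)"
  shows "measure (output_law n p K) X =
         measure_pmf.expectation (replicate_pmf n p) (\<lambda>xs. measure (K xs) X)"
proof -
  have "K \<in> measure_pmf (replicate_pmf n p) \<rightarrow>\<^sub>M subprob_algebra (distribution_space k)"
    using measurable_prob_algebraD[OF K[unfolded estimators_def]] by simp
  then show ?thesis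
    unfolding output_law_def using X by (rule measure_pmf.measure_bind)
qed

lemma estimators_space:
  assumes "K \<in> estimators k"
  shows "prob_space (K xs)" "sets (K xs) = sets (distribution_space k)"
  using measurable_space[OF assms[unfolded estimators_def], of xs]
  by (simp_all add: space_prob_algebra)

text \<open>The sample space carries the discrete sigma-algebra, so any map into
  \<open>distributions k\<close> is measurable, even one defined by arbitrary choice.\<close>

lemma deterministic_estimator:
  assumes "\<And>xs. f xs \<in> distributions k"
  shows "(\<lambda>xs. return (distribution_space k) (f xs)) \<in> estimators k"
  using assms by (auto simp: estimators_def space_prob_algebra intro: prob_space_return)

section \<open>Hellinger affinity and products of test errors\<close>

lemma Cauchy_Schwarz_affinity:
  fixes u v :: "'a \<Rightarrow> real"
  assumes "finite A" "set_pmf p \<subseteq> A" "set_pmf q \<subseteq> A" "0 \<le> c"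
    and "\<And>x. 0 \<le> u x" "\<And>x. 0 \<le> v x" "\<And>x. c \<le> u x * v x"
  shows "c * (\<Sum>x\<in>A. sqrt (pmf p x * pmf q x))\<^sup>2 \<le> measure_pmf.expectation p u * measure_pmf.expectation q v"
proof -
  \<comment> \<open>The lower bound on \<open>u x * v x\<close> enters pointwise; Cauchy-Schwarz
    then separates the two expectations.\<close>
  have "sqrt c * (\<Sum>x\<in>A. sqrt (pmf p x * pmf q x)) \<le> (\<Sum>x\<in>A. sqrt (pmf p x * u x) * sqrt (pmf q x * v x))"
    unfolding sum_distrib_left
  proof (rule sum_mono)
    fix x
    have "sqrt c * sqrt (pmf p x * pmf q x) \<le> sqrt (u x * v x) * sqrt (pmf p x * pmf q x)"
      using assms(7) by (intro mult_right_mono) auto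
    then show "sqrt c * sqrt (pmf p x * pmf q x) \<le> sqrt (pmf p x * u x) * sqrt (pmf q x * v x)"
      by (simp add: real_sqrt_mult mult_ac)
  qed
  then have "(sqrt c * (\<Sum>x\<in>A. sqrt (pmf p x * pmf q x)))\<^sup>2
      \<le> (\<Sum>x\<in>A. sqrt (pmf p x * u x) * sqrt (pmf q x * v x))\<^sup>2"
    using assms(4) by (intro power_mono) (auto intro!: mult_nonneg_nonneg sum_nonneg)
  also have "\<dots> \<le> (\<Sum>x\<in>A. (sqrt (pmf p x * u x))\<^sup>2) * (\<Sum>x\<in>A. (sqrt (pmf q x * v x))\<^sup>2)"
    by (rule Cauchy_Schwarz_ineq_sum)
  also have "\<dots> = measure_pmf.expectation p u * measure_pmf.expectation q v"
    using assms(1-3,5,6) by (simp add: integral_measure_pmf[where A=A] subset_iff)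
  finally show ?thesis
    using assms(4) by (simp add: power_mult_distrib)
qed

text \<open>Tensorization: averaging out the tail gives functions \<open>U\<close> and
  \<open>V\<close> of the head whose product is at least \<open>c\<close> times the
  \<open>n\<close>-th power of the squared affinity. This is the one-sample hypothesis again, with a
  new constant.\<close>

lemma Cauchy_Schwarz_affinity_replicate:
  fixes u v :: "'a list \<Rightarrow> real"
  assumes "finite A" "set_pmf p \<subseteq> A" "set_pmf q \<subseteq> A" "0 \<le> c"
    and "\<And>xs. 0 \<le> u xs" "\<And>xs. 0 \<le> v xs" "\<And>xs. c \<le> u xs * v xs"
  shows "c * ((\<Sum>x\<in>A. sqrt (pmf p x * pmf q x))\<^sup>2) ^ n
      \<le> measure_pmf.expectation (replicate_pmf n p) u * measure_pmf.expectation (replicate_pmf n q) v"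
  using assms(5-)
proof (induction n arbitrary: u v)
  case 0
  then show ?case by simp
next
  case (Suc n)
  let ?\<rho> = "(\<Sum>x\<in>A. sqrt (pmf p x * pmf q x))\<^sup>2"
  define U where "U = (\<lambda>x. measure_pmf.expectation (replicate_pmf n p) (\<lambda>xs. u (x # xs)))"
  define V where "V = (\<lambda>x. measure_pmf.expectation (replicate_pmf n q) (\<lambda>xs. v (x # xs)))"
  have "finite (set_pmf p)" "finite (set_pmf q)"
    using assms by (auto intro: finite_subset)
  moreover have "(c * ?\<rho> ^ n) * ?\<rho> \<le> measure_pmf.expectation p U * measure_pmf.expectation q V"
  proof (rule Cauchy_Schwarz_affinity[OF assms(1-3)])
    show "c * ?\<rho> ^ n \<le> U x * V x" for x
      unfolding U_def V_def using Suc.prems by (intro Suc.IH)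
  qed (use assms(4) Suc.prems in \<open>auto simp: U_def V_def intro!: Bochner_Integration.integral_nonneg\<close>)
  ultimately show ?case
    by (simp add: expectation_replicate_pmf_Suc U_def V_def mult_ac del: replicate_pmf.simps)
qed

definition two_point_pmf :: "real \<Rightarrow> nat pmf" where
  "two_point_pmf r = map_pmf (\<lambda>b. if b then 1 else 2) (bernoulli_pmf r)"

lemma two_point_pmf:
  assumes "0 \<le> r" "r \<le> 1"
  shows "pmf (two_point_pmf r) 1 = r" "pmf (two_point_pmf r) 2 = 1 - r"
    "set_pmf (two_point_pmf r) \<subseteq> {1, 2}"
proof -
  have inj: "inj (\<lambda>b. if b then 1 else 2 :: nat)"
    by (auto simp: inj_def)
  show "pmf (two_point_pmf r) 1 = r" "pmf (two_point_pmf r) 2 = 1 - r"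
    using assms pmf_map_inj'[OF inj, of "bernoulli_pmf r" True] pmf_map_inj'[OF inj, of "bernoulli_pmf r" False]
    by (simp_all add: two_point_pmf_def)
  show "set_pmf (two_point_pmf r) \<subseteq> {1, 2}"
    by (auto simp: two_point_pmf_def)
qed

section \<open>Chunks of a sample and majorities among them\<close>

primrec chunks :: "nat \<Rightarrow> nat \<Rightarrow> 'a list \<Rightarrow> 'a list list" where
  "chunks m 0 xs = []"
| "chunks m (Suc L) xs = take m xs # chunks m L (drop m xs)"

lemma chunks_concat:
  assumes "\<And>ys. ys \<in> set yss \<Longrightarrow> length ys = m"
  shows "chunks m (length yss) (concat yss) = yss"
  using assms by (induction yss) auto

lemma majorities_intersect:
  assumes "length xs < length (filter P xs) + length (filter Q xs)"
  shows "\<exists>x\<in>set xs. P x \<and> Q x"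
  using assms by (induction xs) (auto split: if_splits)

section \<open>Bounding the infimum that defines the sample complexity\<close>

lemma sample_complexity_le:
  assumes "learns d k \<epsilon> \<delta> n K"
  shows "ereal_of_enat (sample_complexity d k \<epsilon> \<delta>) \<le> ereal (real n)"
proof -
  have "sample_complexity d k \<epsilon> \<delta> \<le> enat n"
    unfolding sample_complexity_def using assms by (intro INF_lower) auto
  then have "ereal_of_enat (sample_complexity d k \<epsilon> \<delta>) \<le> ereal_of_enat (enat n)"
    by (simp only: ereal_of_enat_le_iff)
  then show ?thesis by simp
qed

lemma sample_complexity_ge:
  assumes "\<And>n K. learns d k \<epsilon> \<delta> n K \<Longrightarrow> b \<le> real n"
  shows "ereal b \<le> ereal_of_enat (sample_complexity d k \<epsilon> \<delta>)"
proof -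
  define N where "N = {n. \<exists>K. learns d k \<epsilon> \<delta> n K}"
  show ?thesis
  proof (cases "N = {}")
    case True
    then show ?thesis
      by (simp add: sample_complexity_def top_enat_def flip: N_def)
  next
    case False
    then have "Inf (enat ` N) \<in> enat ` N"
      by (auto simp: Inf_enat_def intro: LeastI)
    then obtain n where "n \<in> N" "sample_complexity d k \<epsilon> \<delta> = enat n"
      by (auto simp: sample_complexity_def N_def)
    then show ?thesis
      using assms by (auto simp: N_def)
  qed
qed

text \<open>What the two bounds need of a distance. The shape of \<open>triangle\<close> absorbs the
  use of symmetry, the first coordinate suffices to separate the two-point distributions, and the
  factor 2 in \<open>empirical\<close> is the cost of the two chains in the Kolmogorov case.\<close>

locale learnable_distance =
  fixes d :: distance
  assumes triangle: "1 \<le> k \<Longrightarrow> d k p q \<le> d k p r + d k q r"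
    and separates: "1 \<le> k \<Longrightarrow> \<bar>pmf p 1 - pmf q 1\<bar> \<le> d k p q"
    and measurable: "1 \<le> k \<Longrightarrow> d k p \<in> borel_measurable (distribution_space k)"
    and empirical: "\<lbrakk>1 \<le> k; p \<in> distributions k; 0 < m; 0 < \<eta>\<rbrakk> \<Longrightarrow>
      measure_pmf.prob (replicate_pmf m p) {xs. \<eta> < d k p (empirical xs)} \<le> 2 / (real m * \<eta>\<^sup>2)"
begin

lemma lower_bound:
  assumes K: "learns d k \<epsilon> \<delta> n K" and k: "2 \<le> k"
    and \<epsilon>: "0 < \<epsilon>" "\<epsilon> \<le> 1 / 8" and \<delta>: "0 < \<delta>" "\<delta> \<le> 1 / 16"
  shows "1 / 64 * (ln (1 / \<delta>) / \<epsilon>\<^sup>2) \<le> n"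
proof -
  \<comment> \<open>The shifts put the first coordinates of \<open>p\<close> and \<open>q\<close> at
    distance \<open>4 * \<epsilon>\<close>, more than twice the accuracy, so the two success events
    are disjoint.\<close>
  define p where "p = two_point_pmf (1 / 2 + 2 * \<epsilon>)"
  define q where "q = two_point_pmf (1 / 2 - 2 * \<epsilon>)"
  have p: "pmf p 1 = 1 / 2 + 2 * \<epsilon>" "pmf p 2 = 1 / 2 - 2 * \<epsilon>" "set_pmf p \<subseteq> {1, 2}"
    using two_point_pmf[of "1 / 2 + 2 * \<epsilon>"] \<epsilon> by (simp_all add: p_def)
  have q: "pmf q 1 = 1 / 2 - 2 * \<epsilon>" "pmf q 2 = 1 / 2 + 2 * \<epsilon>" "set_pmf q \<subseteq> {1, 2}"
    using two_point_pmf[of "1 / 2 - 2 * \<epsilon>"] \<epsilon> by (simp_all add: q_def)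
  have pq: "p \<in> distributions k" "q \<in> distributions k"
    using p(3) q(3) k by (auto simp: distributions_def)
  have est: "K \<in> estimators k"
    using K by (simp add: learns_def)
  define X where "X = (\<lambda>r. {s \<in> distributions k. d k r s \<le> \<epsilon>})"
  have X: "X r \<in> sets (distribution_space k)" for r
  proof -
    have [measurable]: "d k r \<in> borel_measurable (distribution_space k)"
      using k by (intro measurable) simp
    have "{s \<in> space (distribution_space k). d k r s \<le> \<epsilon>} \<in> sets (distribution_space k)"
      by measurable
    then show ?thesis by (simp add: X_def)
  qed
  have "X p \<inter> X q = {}"
  proof -
    have "4 * \<epsilon> = \<bar>pmf p 1 - pmf q 1\<bar>"
      using \<epsilon> by (simp add: p q del: One_nat_def)
    also have "\<dots> \<le> d k p q"
      using k by (intro separates) simp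
    also have "d k p q \<le> d k p r + d k q r" for r
      using k by (intro triangle) simp
    finally have "\<not> (d k p r \<le> \<epsilon> \<and> d k q r \<le> \<epsilon>)" for r
      using \<epsilon> by (smt (verit))
    then show ?thesis
      by (auto simp: X_def)
  qed
  have disj: "measure (K xs) (X p) + measure (K xs) (X q) \<le> 1" for xs
  proof -
    interpret prob_space "K xs" using est by (rule estimators_space)
    have "prob (X p) + prob (X q) = prob (X p \<union> X q)"
      using X \<open>X p \<inter> X q = {}\<close> by (intro finite_measure_Union[symmetric]) (simp_all add: estimators_space[OF est])
    then show ?thesis by simp
  qed
  \<comment> \<open>The summand \<open>\<delta>\<close> bounds the product of the two test errors away from 0.\<close>
  define u where "u = (\<lambda>xs. 1 - measure (K xs) (X p) + \<delta>)"
  define v where "v = (\<lambda>xs. 1 - measure (K xs) (X q) + \<delta>)"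
  have fin: "finite (set_pmf p)" "finite (set_pmf q)"
    using p(3) q(3) by (auto intro: finite_subset)
  have learn: "1 - \<delta> \<le> measure_pmf.expectation (replicate_pmf n r) (\<lambda>xs. measure (K xs) (X r))"
    if "r \<in> distributions k" for r
    using K that measure_output_law[OF est X, of n r r] by (auto simp: learns_def X_def)
  have "\<delta> * ((\<Sum>x\<in>{1, 2}. sqrt (pmf p x * pmf q x))\<^sup>2) ^ n
      \<le> measure_pmf.expectation (replicate_pmf n p) u * measure_pmf.expectation (replicate_pmf n q) v"
  proof (rule Cauchy_Schwarz_affinity_replicate)
    fix xs
    have le1: "measure (K xs) (X p) \<le> 1" "measure (K xs) (X q) \<le> 1"
      using prob_space.prob_le_1[OF estimators_space(1)[OF est]] by blast+
    then show "0 \<le> u xs" "0 \<le> v xs"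
      using \<delta> by (simp_all add: u_def v_def)
    \<comment> \<open>\<open>a\<close> is at most \<open>b\<close> because the success events are
      disjoint. The cross terms of \<open>(1 - a + \<delta>) * (a + \<delta>)\<close> alone add up
      to \<open>\<delta>\<close>.\<close>
    define a where "a = measure (K xs) (X p)"
    define b where "b = 1 - measure (K xs) (X q)"
    have ab: "0 \<le> a" "a \<le> 1" "a \<le> b"
      using le1 disj[of xs] by (simp_all add: a_def b_def)
    have "\<delta> \<le> (1 - a) * a + \<delta> * \<delta> + \<delta>"
      using ab by simp
    also have "\<dots> = (1 - a + \<delta>) * (a + \<delta>)"
      by (simp add: algebra_simps)
    also have "\<dots> \<le> (1 - a + \<delta>) * (b + \<delta>)"
      using ab \<delta> by (intro mult_left_mono) auto
    finally show "\<delta> \<le> u xs * v xs"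
      by (simp add: u_def v_def a_def b_def)
  qed (use p(3) q(3) \<delta> in auto)
  \<comment> \<open>Each test error has mean at most \<open>\<delta>\<close> by the learning
    guarantee; the added summand doubles the bound.\<close>
  also have "\<dots> \<le> (2 * \<delta>) * (2 * \<delta>)"
  proof (intro mult_mono)
    show "measure_pmf.expectation (replicate_pmf n p) u \<le> 2 * \<delta>"
      using learn[OF pq(1)] unfolding u_def
      by (simp add: integrable_measure_pmf_finite finite_set_replicate_pmf fin)
    show "measure_pmf.expectation (replicate_pmf n q) v \<le> 2 * \<delta>"
      using learn[OF pq(2)] unfolding v_def
      by (simp add: integrable_measure_pmf_finite finite_set_replicate_pmf fin)
    show "0 \<le> measure_pmf.expectation (replicate_pmf n q) v"
      using \<delta> prob_space.prob_le_1[OF estimators_space(1)[OF est]]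
      by (intro Bochner_Integration.integral_nonneg) (auto simp: v_def add_nonneg_nonneg)
  qed (use \<delta> in auto)
  also have "(\<Sum>x\<in>{1, 2}. sqrt (pmf p x * pmf q x))\<^sup>2 = 1 - 16 * \<epsilon>\<^sup>2"
  proof -
    have "(1 / 2 + 2 * \<epsilon>) * (1 / 2 - 2 * \<epsilon>) \<ge> 0"
      using \<epsilon> by (intro mult_nonneg_nonneg) auto
    moreover have "(\<Sum>x\<in>{1, 2}. sqrt (pmf p x * pmf q x)) = 2 * sqrt ((1 / 2 + 2 * \<epsilon>) * (1 / 2 - 2 * \<epsilon>))"
      by (simp add: p q mult.commute del: One_nat_def)
    ultimately have "(\<Sum>x\<in>{1, 2}. sqrt (pmf p x * pmf q x))\<^sup>2 = 4 * ((1 / 2 + 2 * \<epsilon>) * (1 / 2 - 2 * \<epsilon>))"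
      by (simp only: power_mult_distrib real_sqrt_pow2) simp
    then show ?thesis by (simp add: power2_eq_square algebra_simps)
  qed
  finally have main: "(1 - 16 * \<epsilon>\<^sup>2) ^ n \<le> 4 * \<delta>"
    using \<delta> by simp
  have "\<epsilon> * \<epsilon> \<le> 1 / 8 * (1 / 8)"
    using \<epsilon> by (intro mult_mono) auto
  then have e2: "16 * \<epsilon>\<^sup>2 \<le> 1 / 4" by (simp add: power2_eq_square)
  \<comment> \<open>For x = \<open>16 * \<epsilon>\<^sup>2\<close> at most 1/4, 2 x^2 <= x, so ln (1
    - x) >= - 2 x.\<close>
  have "- (16 * \<epsilon>\<^sup>2) - 2 * (16 * \<epsilon>\<^sup>2)\<^sup>2 \<le> ln (1 - 16 * \<epsilon>\<^sup>2)"
    using e2 by (intro ln_one_minus_pos_lower_bound) auto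
  moreover have "(16 * \<epsilon>\<^sup>2) * (16 * \<epsilon>\<^sup>2) \<le> 16 * \<epsilon>\<^sup>2 * (1 / 2)"
    using e2 by (intro mult_left_mono) auto
  ultimately have "- (32 * \<epsilon>\<^sup>2) \<le> ln (1 - 16 * \<epsilon>\<^sup>2)"
    by (simp add: power2_eq_square[of "16 * \<epsilon>\<^sup>2"])
  then have "n * - (32 * \<epsilon>\<^sup>2) \<le> n * ln (1 - 16 * \<epsilon>\<^sup>2)"
    by (rule mult_left_mono) simp
  also have "\<dots> = ln ((1 - 16 * \<epsilon>\<^sup>2) ^ n)"
    using e2 by (simp add: ln_realpow)
  also have "\<dots> \<le> ln (4 * \<delta>)"
    using main e2 \<delta> by (intro ln_mono) auto
  finally have bound: "- (32 * n * \<epsilon>\<^sup>2) \<le> ln (4 * \<delta>)"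
    by simp
  \<comment> \<open>Since \<open>\<delta> \<le> 1 / 16\<close>, the square of
    \<open>4 * \<delta>\<close> is at most \<open>\<delta>\<close>. Removing the factor 4 thus costs
    a factor 2 in the logarithm and turns 32 into 64.\<close>
  have "2 * ln (4 * \<delta>) = ln ((4 * \<delta>)\<^sup>2)"
    using \<delta> by (subst ln_realpow) auto
  also have "\<dots> \<le> ln \<delta>"
    using \<delta> by (intro ln_mono) (auto simp: power2_eq_square)
  finally have "ln (1 / \<delta>) \<le> 64 * n * \<epsilon>\<^sup>2"
    using bound \<delta> by (simp add: ln_div)
  then show ?thesis
    using \<epsilon> by (simp add: field_simps)
qed

text \<open>The sample is cut into \<^term>\<open>L\<close> chunks of size \<^term>\<open>m\<close>, and the output is any distribution
  that is \<open>\<epsilon>/2\<close>-close to the empirical distributions of a majority of the chunks. If \<^term>\<open>p\<close> itself has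
  this property, then the two majorities share a chunk, so \<^term>\<open>p\<close> and the output are \<open>\<epsilon>\<close>-close.\<close>
lemma boosting:
  assumes k: "1 \<le> k" and \<epsilon>: "0 < \<epsilon>" and m: "0 < m" "288 / \<epsilon>\<^sup>2 \<le> m" and L: "(1 / 3) ^ L \<le> \<delta>"
  shows "\<exists>K. learns d k \<epsilon> \<delta> (L * m) K"
proof -
  \<comment> \<open>The majority is strict, so that any two of them share a chunk.\<close>
  define good where "good = (\<lambda>q yss. L < 2 * length (filter (\<lambda>ys. d k q (empirical ys) \<le> \<epsilon> / 2) yss))"
  \<comment> \<open>The fallback point mass keeps \<open>f\<close> inside
    \<open>distributions k\<close> on lists that admit no candidate.\<close>
  define f where "f = (\<lambda>xs. if \<exists>q\<in>distributions k. good q (chunks m L xs)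
      then SOME q. q \<in> distributions k \<and> good q (chunks m L xs) else return_pmf 1)"
  have f: "f xs \<in> distributions k \<and> good (f xs) (chunks m L xs)"
    if "q \<in> distributions k" "good q (chunks m L xs)" for q xs
    using someI[of "\<lambda>q. q \<in> distributions k \<and> good q (chunks m L xs)" q] that by (auto simp: f_def)
  have f_dist: "f xs \<in> distributions k" for xs
  proof (cases "\<exists>q\<in>distributions k. good q (chunks m L xs)")
    case True
    then show ?thesis using f by blast
  next
    case False
    then have "f xs = return_pmf 1" by (simp only: f_def if_False)
    then show ?thesis using k by (simp add: distributions_def)
  qed
  define K where "K = (\<lambda>xs. return (distribution_space k) (f xs))"
  have K: "K \<in> estimators k"
    unfolding K_def using f_dist by (rule deterministic_estimator)
  have "1 - \<delta> \<le> measure (output_law (L * m) p K) {q \<in> distributions k. d k p q \<le> \<epsilon>}"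
    if p: "p \<in> distributions k" for p
  proof -
    define X where "X = {q \<in> distributions k. d k p q \<le> \<epsilon>}"
    define bad where "bad = {ys. \<epsilon> / 2 < d k p (empirical ys)}"
    define R where "R = replicate_pmf L (replicate_pmf m p)"
    have [measurable]: "d k p \<in> borel_measurable (distribution_space k)"
      using k by (rule measurable)
    have "{q \<in> space (distribution_space k). d k p q \<le> \<epsilon>} \<in> sets (distribution_space k)"
      by measurable
    then have X: "X \<in> sets (distribution_space k)"
      by (simp add: X_def)
    \<comment> \<open>288 = 2 * 4 * 36: the 2 comes from \<open>empirical\<close>, the 4 from
      halving \<open>\<epsilon>\<close>, the 36 from the failure probability required by
      \<open>replicate_pmf_majority\<close>.\<close>
    have "measure_pmf.prob (replicate_pmf m p) bad \<le> 2 / (real m * (\<epsilon> / 2)\<^sup>2)"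
      unfolding bad_def using k p m \<epsilon> by (intro empirical) auto
    also have "\<dots> \<le> 1 / 36"
      using m \<epsilon> by (simp add: field_simps power2_eq_square)
    finally have "measure_pmf.prob R {yss. L \<le> 2 * length (filter (\<lambda>ys. ys \<in> bad) yss)} \<le> (1 / 3) ^ L"
      unfolding R_def using finite_set_replicate_pmf[OF finite_set_distributions[OF p]]
      by (intro replicate_pmf_majority)
    then have "1 - \<delta> \<le> 1 - measure_pmf.prob R {yss. L \<le> 2 * length (filter (\<lambda>ys. ys \<in> bad) yss)}"
      using L by simp
    also have "\<dots> = measure_pmf.prob R (- {yss. L \<le> 2 * length (filter (\<lambda>ys. ys \<in> bad) yss)})"
      by (simp add: prob_Compl)
    \<comment> \<open>With fewer than half of the chunks bad, \<open>p\<close> itself is a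
      candidate, so the choice in \<open>f\<close> succeeds.\<close>
    also have "\<dots> \<le> measure_pmf.prob R {yss. f (concat yss) \<in> X}"
    proof (rule measure_pmf.finite_measure_mono_AE)
      show "AE yss in R. yss \<in> - {yss. L \<le> 2 * length (filter (\<lambda>ys. ys \<in> bad) yss)} \<longrightarrow>
          yss \<in> {yss. f (concat yss) \<in> X}"
      proof (intro AE_pmfI impI)
        fix yss assume "yss \<in> set_pmf R"
          and few: "yss \<in> - {yss. L \<le> 2 * length (filter (\<lambda>ys. ys \<in> bad) yss)}"
        then have len: "length yss = L" "\<And>ys. ys \<in> set yss \<Longrightarrow> length ys = m"
          by (auto simp: R_def set_replicate_pmf)
        then have chunks: "chunks m L (concat yss) = yss"
          using chunks_concat[of yss m] by simp
        have "length (filter (\<lambda>ys. ys \<in> bad) yss) + length (filter (\<lambda>ys. ys \<notin> bad) yss) = L"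
          using len sum_length_filter_compl[of "\<lambda>ys. ys \<in> bad" yss] by simp
        then have good: "good p yss"
          using few by (simp add: good_def bad_def not_less)
        then have "good (f (concat yss)) yss"
          using f[OF p, of "concat yss"] by (simp add: chunks)
        with good have "length yss < length (filter (\<lambda>ys. d k p (empirical ys) \<le> \<epsilon> / 2) yss)
            + length (filter (\<lambda>ys. d k (f (concat yss)) (empirical ys) \<le> \<epsilon> / 2) yss)"
          by (simp add: good_def len)
        then obtain ys where "d k p (empirical ys) \<le> \<epsilon> / 2" "d k (f (concat yss)) (empirical ys) \<le> \<epsilon> / 2"
          using majorities_intersect by blast
        then have "d k p (f (concat yss)) \<le> \<epsilon>"
          using triangle[OF k, of p "f (concat yss)" "empirical ys"] by simp
        then show "yss \<in> {yss. f (concat yss) \<in> X}"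
          by (simp add: X_def f_dist)
      qed
    qed simp
    also have "\<dots> = measure_pmf.prob (map_pmf concat R) {xs. f xs \<in> X}"
      by (simp add: vimage_def)
    also have "\<dots> = measure_pmf.expectation (replicate_pmf (L * m) p) (indicator {xs. f xs \<in> X})"
      by (simp add: R_def replicate_pmf_mult)
    also have "\<dots> = measure (output_law (L * m) p K) X"
      unfolding measure_output_law[OF K X]
      by (intro Bochner_Integration.integral_cong refl)
        (simp add: K_def measure_return[OF X] indicator_def)
    finally show ?thesis
      by (simp add: X_def)
  qed
  with K show ?thesis
    by (auto simp: learns_def)
qed

lemma upper_bound:
  assumes k: "1 \<le> k" and \<epsilon>: "0 < \<epsilon>" "\<epsilon> \<le> 1" and \<delta>: "0 < \<delta>" "\<delta> \<le> 1 / 16"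
  shows "\<exists>n K. learns d k \<epsilon> \<delta> n K \<and> n \<le> 578 * (ln (1 / \<delta>) / \<epsilon>\<^sup>2)"
proof -
  define m where "m = nat \<lceil>288 / \<epsilon>\<^sup>2\<rceil>"
  define L where "L = nat \<lceil>ln (1 / \<delta>)\<rceil>"
  \<comment> \<open>Both \<open>ln (1 / \<delta>)\<close> and \<open>1 / \<epsilon>\<^sup>2\<close>
    are at least 1, which absorbs the rounding: a factor 2 for \<open>L\<close>, and 289 instead of
    288 for \<open>m\<close>. Hence 578 = 2 * 289.\<close>
  have "1 \<le> ln (1 / \<delta>)"
  proof -
    have "3 \<le> 1 / \<delta>"
      using \<delta> by (simp add: field_simps)
    with exp_le have "exp 1 \<le> 1 / \<delta>"
      by (rule order_trans)
    then show ?thesis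
      using \<delta> by (simp add: ln_ge_iff)
  qed
  then have L: "ln (1 / \<delta>) \<le> L" "L \<le> 2 * ln (1 / \<delta>)"
    unfolding L_def by linarith+
  have "1 \<le> 1 / \<epsilon>\<^sup>2"
    using \<epsilon> by (simp add: power_le_one)
  then have m: "288 / \<epsilon>\<^sup>2 \<le> m" "m \<le> 289 / \<epsilon>\<^sup>2" "0 < m"
    unfolding m_def by linarith+
  have "(1 / 3 :: real) ^ L \<le> exp (- 1) ^ L"
    using exp_le by (intro power_mono) (auto simp: exp_minus field_simps)
  also have "\<dots> = exp (- real L)"
    by (simp flip: exp_of_nat_mult)
  also have "\<dots> \<le> exp (- ln (1 / \<delta>))"
    using L by simp
  also have "\<dots> = \<delta>"
    using \<delta> by (simp add: ln_div)
  finally obtain K where "learns d k \<epsilon> \<delta> (L * m) K"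
    using boosting[OF k \<epsilon>(1) m(3,1)] by blast
  moreover have "real (L * m) \<le> (2 * ln (1 / \<delta>)) * (289 / \<epsilon>\<^sup>2)"
    unfolding of_nat_mult using L m \<open>1 \<le> ln (1 / \<delta>)\<close> by (intro mult_mono) auto
  ultimately show ?thesis by (intro exI[of _ "L * m"] exI[of _ K]) simp
qed

theorem is_Theta_sample_complexity:
  "is_Theta (sample_complexity d) (\<lambda>k \<epsilon> \<delta>. ln (1 / \<delta>) / \<epsilon>\<^sup>2)"
  unfolding is_Theta_def
proof (intro exI conjI allI impI)
  fix k :: nat and \<epsilon> \<delta> :: real
  \<comment> \<open>This range fixes the thresholds for \<open>k\<close>, \<open>\<epsilon>\<close>
    and \<open>\<delta>\<close>; the constants are \<open>c = 1 / 64\<close> and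
    \<open>C = 578\<close>.\<close>
  assume *: "2 \<le> k" "0 < \<epsilon>" "\<epsilon> \<le> 1 / 8" "0 < \<delta>" "\<delta> \<le> 1 / 16"
  show "ereal (1 / 64 * (ln (1 / \<delta>) / \<epsilon>\<^sup>2)) \<le> ereal_of_enat (sample_complexity d k \<epsilon> \<delta>)"
    using * by (intro sample_complexity_ge lower_bound)
  obtain n K where "learns d k \<epsilon> \<delta> n K" "real n \<le> 578 * (ln (1 / \<delta>) / \<epsilon>\<^sup>2)"
    using upper_bound[of k \<epsilon> \<delta>] * by auto
  then show "ereal_of_enat (sample_complexity d k \<epsilon> \<delta>) \<le> ereal (578 * (ln (1 / \<delta>) / \<epsilon>\<^sup>2))"
    using sample_complexity_le[of d k \<epsilon> \<delta> n K] by (auto intro: order_trans)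
qed auto

end

section \<open>The three distances as instances\<close>

interpretation kolmogorov: learnable_distance kolmogorov_dist
proof
  show "kolmogorov_dist k p q \<le> kolmogorov_dist k p r + kolmogorov_dist k q r" if "1 \<le> k" for k p q r
    unfolding kolmogorov_dist_def using that by (intro MAX_abs_diff_triangle) auto
qed (rule pmf_1_diff_le_kolmogorov_dist borel_measurable_kolmogorov_dist kolmogorov_dist_empirical; assumption)+

interpretation l2: learnable_distance l2_dist
proof
  show "\<bar>pmf p 1 - pmf q 1\<bar> \<le> l2_dist k p q" if "1 \<le> k" for k p q
    using pmf_diff_le_linf_dist[of 1 k p q] linf_dist_le_l2_dist[OF that, of p q] that by simp
  show "measure_pmf.prob (replicate_pmf m p) {xs. \<eta> < l2_dist k p (empirical xs)} \<le> 2 / (real m * \<eta>\<^sup>2)"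
    if "p \<in> distributions k" "0 < m" "0 < \<eta>" for k p m \<eta>
    by (rule order_trans[OF l2_dist_empirical[OF that]]) (simp add: divide_right_mono)
qed (auto intro: l2_dist_triangle borel_measurable_l2_dist)

interpretation linf: learnable_distance linf_dist
proof
  show "linf_dist k p q \<le> linf_dist k p r + linf_dist k q r" if "1 \<le> k" for k p q r
    unfolding linf_dist_def using that by (intro MAX_abs_diff_triangle) auto
  show "measure_pmf.prob (replicate_pmf m p) {xs. \<eta> < linf_dist k p (empirical xs)} \<le> 2 / (real m * \<eta>\<^sup>2)"
    if "1 \<le> k" "p \<in> distributions k" "0 < m" "0 < \<eta>" for k p m \<eta>
  proof -
    have "measure_pmf.prob (replicate_pmf m p) {xs. \<eta> < linf_dist k p (empirical xs)}
        \<le> measure_pmf.prob (replicate_pmf m p) {xs. \<eta> < l2_dist k p (empirical xs)}"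
      by (intro measure_pmf.finite_measure_mono) (auto intro: less_le_trans linf_dist_le_l2_dist[OF that(1)])
    also have "\<dots> \<le> 2 / (real m * \<eta>\<^sup>2)"
      using that by (rule l2.empirical)
    finally show ?thesis .
  qed
qed (auto intro!: pmf_diff_le_linf_dist borel_measurable_linf_dist simp del: One_nat_def)

theorem theorem9:
  "is_Theta (sample_complexity kolmogorov_dist) (\<lambda>k \<epsilon> \<delta>. ln (1 / \<delta>) / \<epsilon>\<^sup>2) \<and>
   is_Theta (sample_complexity linf_dist) (\<lambda>k \<epsilon> \<delta>. ln (1 / \<delta>) / \<epsilon>\<^sup>2) \<and>
   is_Theta (sample_complexity l2_dist) (\<lambda>k \<epsilon> \<delta>. ln (1 / \<delta>) / \<epsilon>\<^sup>2)"
  using kolmogorov.is_Theta_sample_complexity linf.is_Theta_sample_complexity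
    l2.is_Theta_sample_complexity by blast

end
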